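(* Let $G$ and $H$ be finitely generated free groups with the rank of $H$ greater than $1$. \begin{itemize} \item If $G=H$, and for an endomorphism $\phi:G\to G$ and $u,v\in G$ we write $[u]=[v]$ when there is $z\in G$ with $u=\phi(z)vz^{-1}$ (i.e. $[u]$ is the singly-twisted conjugacy class of $u$ with respect to $\phi$), then the set \[ \{(\phi,u,v)\mid [u]\ne[v]\} \] of triples consisting of an endomorphism $\phi$ of $G$ and elements $u,v\in G$ is generic. \item For homomorphisms $\phi:G\to H$ and elements $u,v\in H$, the set \[ \{(\phi,u,v)\mid uv^{-1}\notin\phi(G)\} \] is generic. \end{itemize}
   Context: Fix free generators $a_1,\dots,a_n$ of $G$ and a free generating set of $H$. A homomorphism $\phi:G\to H$ is identified with $(\phi(a_1),\dots,\phi(a_n))\in H^n$, and a triple $(\phi,u,v)$ with $(\phi(a_1),\dots,\phi(a_n),u,v)\in H^{n+2}$. For a natural number $p$, $H_p$ is the set of elements of $H$ of reduced word length at most $p$. The asymptotic density of $S\subset H^l$ is \[ D(S)=\lim_{p\to\infty}\frac{|S\cap(H_p)^l|}{|(H_p)^l|}, \] with $|\cdot|$ cardinality, and $S$ is generic if $D(S)=1$. *)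

theory Defs
  imports Complex_Main "HOL-Algebra.Group"
begin

text \<open>The letter \<open>(x, True)\<close> stands for \<open>x\<close> and \<open>(x, False)\<close> for the inverse of \<open>x\<close>.\<close>

type_synonym 'a word = "('a \<times> bool) list"

definition reduced :: "'a word \<Rightarrow> bool" where
  "reduced w \<longleftrightarrow> successively (\<lambda>(x, s) (y, t). \<not> (x = y \<and> s \<noteq> t)) w"

definition reduced_words :: "'a set \<Rightarrow> 'a word set" where
  "reduced_words B = {w. fst ` set w \<subseteq> B \<and> reduced w}"

definition word_value :: "('a, 'c) monoid_scheme \<Rightarrow> 'a word \<Rightarrow> 'a" where
  "word_value G w =
     foldr (\<lambda>(x, s) y. (if s then x else inv\<^bsub>G\<^esub> x) \<otimes>\<^bsub>G\<^esub> y) w \<one>\<^bsub>G\<^esub>"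

text \<open>\<open>G\<close> is a free group with free generating set \<open>B\<close>: each element of \<open>G\<close> is the value of
  exactly one reduced word over \<open>B\<close>.\<close>

definition free_generating_set :: "('a, 'c) monoid_scheme \<Rightarrow> 'a set \<Rightarrow> bool" where
  "free_generating_set G B \<longleftrightarrow>
     group G \<and> B \<subseteq> carrier G \<and> bij_betw (word_value G) (reduced_words B) (carrier G)"

text \<open>A finite free generating set, enumerated without repetition; the empty list is a list of
  free generators of the trivial group.\<close>

definition free_generators :: "('a, 'c) monoid_scheme \<Rightarrow> 'a list \<Rightarrow> bool" where
  "free_generators G as \<longleftrightarrow> distinct as \<and> free_generating_set G (set as)"

definition reduced_length :: "('a, 'c) monoid_scheme \<Rightarrow> 'a set \<Rightarrow> 'a \<Rightarrow> nat" where
  "reduced_length G B x = length (the_inv_into (reduced_words B) (word_value G) x)"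

definition word_ball :: "('a, 'c) monoid_scheme \<Rightarrow> 'a set \<Rightarrow> nat \<Rightarrow> 'a set" where
  "word_ball G B p = {x \<in> carrier G. reduced_length G B x \<le> p}"

text \<open>The Cartesian power of a set, its elements being represented as lists.\<close>

definition tuples :: "nat \<Rightarrow> 'a set \<Rightarrow> 'a list set" where
  "tuples l A = {xs. set xs \<subseteq> A \<and> length xs = l}"

definition has_asymptotic_density ::
    "('a, 'c) monoid_scheme \<Rightarrow> 'a set \<Rightarrow> nat \<Rightarrow> 'a list set \<Rightarrow> real \<Rightarrow> bool" where
  "has_asymptotic_density G B l S d \<longleftrightarrow>
     (\<lambda>p. real (card (S \<inter> tuples l (word_ball G B p))) / real (card (tuples l (word_ball G B p))))
       \<longlonglongrightarrow> d"

definition generic :: "('a, 'c) monoid_scheme \<Rightarrow> 'a set \<Rightarrow> nat \<Rightarrow> 'a list set \<Rightarrow> bool" where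
  "generic G B l S \<longleftrightarrow> S \<subseteq> tuples l (carrier G) \<and> has_asymptotic_density G B l S 1"

text \<open>The relation \<open>[u] = [v]\<close> between singly-twisted conjugacy classes.\<close>

definition twisted_conjugate ::
    "('a, 'c) monoid_scheme \<Rightarrow> ('a \<Rightarrow> 'a) \<Rightarrow> 'a \<Rightarrow> 'a \<Rightarrow> bool" where
  "twisted_conjugate G \<phi> u v \<longleftrightarrow>
     (\<exists>z \<in> carrier G. u = \<phi> z \<otimes>\<^bsub>G\<^esub> v \<otimes>\<^bsub>G\<^esub> inv\<^bsub>G\<^esub> z)"

text \<open>Given free generators \<open>as\<close> of the domain, a homomorphism is encoded by its values on \<open>as\<close>.\<close>

definition triple_code :: "'a list \<Rightarrow> ('a \<Rightarrow> 'b) \<Rightarrow> 'b \<Rightarrow> 'b \<Rightarrow> 'b list" where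
  "triple_code as \<phi> u v = map \<phi> as @ [u, v]"

end

theory Submission
  imports Defs
begin

text \<open>Let \<open>N p\<close> be the size of the ball of radius \<open>p\<close> and \<open>d = p div 4\<close>. Outside a proportion
  \<open>O(N (p - d) / N p) = O(2 ^ - d)\<close> of the tuples, the images \<open>h\<^sub>i\<close> of the generators have length at
  least \<open>3 d\<close>, and the words \<open>h\<^sub>i\<close>, \<open>h\<^sub>i\<^sup>-\<^sup>1\<close> have pairwise different prefixes of length \<open>d\<close>. Then
  fewer than \<open>d\<close> letters cancel at each junction of a product, so \<open>\<phi> z\<close> has length at least
  \<open>d \<cdot> |z|\<close>. If \<open>u = \<phi> z \<cdot> v \<cdot> (g z)\<^sup>-\<^sup>1\<close>, where \<open>g\<close> is the identity in the first part and trivial in the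
  second one, then \<open>d \<cdot> |z| \<le> 2 p + C \<cdot> |z|\<close>, which leaves finitely many \<open>z\<close> independently of \<open>p\<close>. For
  each of them \<open>u\<close> is determined by \<open>\<phi>\<close> and \<open>v\<close>, which is again a negligible event.\<close>

section \<open>Words\<close>

definition inv_word :: "'a word \<Rightarrow> 'a word" where
  "inv_word w = rev (map (apsnd Not) w)"

lemma inv_word_Nil [simp]: "inv_word [] = []"
  by (simp add: inv_word_def)

lemma inv_word_Cons: "inv_word ((x, s) # w) = inv_word w @ [(x, \<not> s)]"
  by (simp add: inv_word_def)

lemma inv_word_append: "inv_word (v @ w) = inv_word w @ inv_word v"
  by (simp add: inv_word_def)

lemma inv_word_inv_word [simp]: "inv_word (inv_word w) = w"
  by (induction w) (auto simp: inv_word_Cons inv_word_append)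

lemma length_inv_word [simp]: "length (inv_word w) = length w"
  by (simp add: inv_word_def)

lemma fst_set_inv_word [simp]: "fst ` set (inv_word w) = fst ` set w"
  by (auto simp: inv_word_def image_image)

lemma inv_word_inject [simp]: "inv_word v = inv_word w \<longleftrightarrow> v = w"
  by (metis inv_word_inv_word)

lemma inv_word_eq_Nil [simp]: "inv_word w = [] \<longleftrightarrow> w = []"
  by (simp add: inv_word_def)

lemma map_inv_word: "map (map_prod f id) (inv_word w) = inv_word (map (map_prod f id) w)"
  by (auto simp: inv_word_def rev_map)

lemma reduced_Nil [simp]: "reduced []"
  by (simp add: reduced_def)

lemma reduced_singleton [simp]: "reduced [x]"
  by (simp add: reduced_def)

lemma reduced_append_iff:
  "reduced (v @ w) \<longleftrightarrow>
     reduced v \<and> reduced w \<and> (v \<noteq> [] \<longrightarrow> w \<noteq> [] \<longrightarrow> hd w \<noteq> apsnd Not (last v))"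
  unfolding reduced_def successively_append_iff
  by (cases "last v"; cases "hd w") auto

lemma reduced_Cons_iff:
  "reduced (x # w) \<longleftrightarrow> reduced w \<and> (w \<noteq> [] \<longrightarrow> hd w \<noteq> apsnd Not x)"
  using reduced_append_iff[of "[x]" w] by simp

lemma reduced_inv_word [simp]: "reduced (inv_word w) \<longleftrightarrow> reduced w"
proof -
  have imp: "reduced w \<Longrightarrow> reduced (inv_word w)" for w :: "'a word"
  proof (induction w)
    case (Cons x w)
    obtain a s where x: "x = (a, s)" by (cases x)
    have "last (inv_word w) = apsnd Not (hd w)" if "w \<noteq> []"
      using that by (cases w) (auto simp: inv_word_def)
    with Cons show ?case
      by (cases "hd w") (auto simp: x inv_word_Cons reduced_append_iff reduced_Cons_iff)
  qed simp
  show ?thesis using imp[of w] imp[of "inv_word w"] by auto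
qed

text \<open>Cancellation only compares letters for equality, so an injective renaming neither
  creates nor destroys it. This allows generators to be replaced by their indices.\<close>

lemma reduced_map:
  assumes "inj_on f (fst ` set w)"
  shows "reduced (map (map_prod f id) w) \<longleftrightarrow> reduced w"
  using assms
proof (induction w)
  case (Cons x w)
  have "f (fst (hd w)) = f (fst x) \<longleftrightarrow> fst (hd w) = fst x" if "w \<noteq> []"
    using Cons.prems that by (intro inj_on_eq_iff[OF Cons.prems]) auto
  with Cons show ?case
    by (cases x; cases "hd w") (auto simp: reduced_Cons_iff hd_map)
qed simp

lemma reduced_words_inv_word [simp]: "inv_word w \<in> reduced_words B \<longleftrightarrow> w \<in> reduced_words B"
  by (simp add: reduced_words_def)

lemma Nil_in_reduced_words [simp]: "[] \<in> reduced_words B"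
  by (simp add: reduced_words_def)

lemma drop_in_reduced_words: "w \<in> reduced_words B \<Longrightarrow> drop d w \<in> reduced_words B"
  using reduced_append_iff[of "take d w" "drop d w"]
  by (auto simp: reduced_words_def dest: in_set_dropD)

text \<open>Meant for the inverse of a left factor and a right factor: their longest common prefix
  is the part that cancels in the product.\<close>

lemma common_prefix_decomposition:
  obtains c v' w' where "v = c @ v'" "w = c @ w'" "v' \<noteq> [] \<Longrightarrow> w' \<noteq> [] \<Longrightarrow> hd v' \<noteq> hd w'"
proof -
  have "\<exists>c v' w'. v = c @ v' \<and> w = c @ w' \<and> (v' \<noteq> [] \<longrightarrow> w' \<noteq> [] \<longrightarrow> hd v' \<noteq> hd w')"
  proof (induction v arbitrary: w)
    case (Cons a v)
    show ?case
    proof (cases "w \<noteq> [] \<and> hd w = a")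
      case True
      then obtain w1 where "w = a # w1" by (cases w) auto
      with Cons.IH[of w1] show ?thesis by (metis append_Cons)
    next
      case False
      then show ?thesis by (intro exI[of _ "[]"] exI[of _ "a # v"] exI[of _ w]) auto
    qed
  qed simp
  then show ?thesis using that by blast
qed

section \<open>Values of words in a group\<close>

context group
begin

lemma word_value_Nil [simp]: "word_value G [] = \<one>"
  by (simp add: word_value_def)

lemma word_value_Cons:
  "word_value G ((x, s) # w) = (if s then x else inv x) \<otimes> word_value G w"
  by (simp add: word_value_def)

lemma word_value_closed: "fst ` set w \<subseteq> carrier G \<Longrightarrow> word_value G w \<in> carrier G"
  by (induction w) (auto simp: word_value_Cons)

lemma word_value_append:
  assumes "fst ` set v \<subseteq> carrier G" "fst ` set w \<subseteq> carrier G"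
  shows "word_value G (v @ w) = word_value G v \<otimes> word_value G w"
  using assms(1)
proof (induction v)
  case Nil
  then show ?case using word_value_closed[OF assms(2)] by simp
next
  case (Cons x v)
  then show ?case using word_value_closed[OF assms(2)] word_value_closed[of v]
    by (cases x) (auto simp: word_value_Cons m_assoc)
qed

lemma word_value_inv_word:
  "fst ` set w \<subseteq> carrier G \<Longrightarrow> word_value G (inv_word w) = inv (word_value G w)"
proof (induction w)
  case (Cons x w)
  obtain a s where x: "x = (a, s)" by (cases x)
  from Cons.prems have a: "a \<in> carrier G" and w: "fst ` set w \<subseteq> carrier G"
    by (auto simp: x)
  show ?case
    using a Cons.IH[OF w] word_value_closed[OF w] w
    by (simp add: x inv_word_Cons word_value_append word_value_Cons inv_mult_group)
qed simp

text \<open>No word is assumed reduced, so the same cancellation serves for normal forms and for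
  their images under an arbitrary assignment of letters.\<close>

lemma word_value_cancel:
  assumes "fst ` set v \<subseteq> carrier G" "fst ` set c \<subseteq> carrier G" "fst ` set w \<subseteq> carrier G"
  shows "word_value G (v @ inv_word c) \<otimes> word_value G (c @ w) = word_value G (v @ w)"
proof -
  note cl = assms[THEN word_value_closed]
  have "word_value G (v @ inv_word c) \<otimes> word_value G (c @ w) =
      word_value G v \<otimes> (inv (word_value G c) \<otimes> (word_value G c \<otimes> word_value G w))"
    using cl assms by (simp add: word_value_append word_value_inv_word m_assoc)
  also have "\<dots> = word_value G (v @ w)"
    using cl assms by (simp add: word_value_append inv_solve_left' flip: m_assoc)
  finally show ?thesis .
qed

end

lemma hom_word_value:
  assumes "group G" "group H" "\<phi> \<in> hom G H" "fst ` set w \<subseteq> carrier G"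
  shows "\<phi> (word_value G w) = word_value H (map (map_prod \<phi> id) w)"
proof -
  interpret group_hom G H \<phi>
    using assms by (simp add: group_hom_def group_hom_axioms_def)
  show ?thesis using assms(4)
  proof (induction w)
    case (Cons x w)
    then show ?case using G.word_value_closed[of w]
      by (cases x) (auto simp: G.word_value_Cons H.word_value_Cons)
  qed simp
qed

section \<open>Groups with a free generating set\<close>

locale free_basis = group G for G (structure) +
  fixes B :: "'a set"
  assumes free_generating: "free_generating_set G B"
begin

definition nf :: "'a \<Rightarrow> 'a word" where
  "nf x = the_inv_into (reduced_words B) (word_value G) x"

lemma basis_subset: "B \<subseteq> carrier G"
  using free_generating by (simp add: free_generating_set_def)

lemma bij_word_value: "bij_betw (word_value G) (reduced_words B) (carrier G)"
  using free_generating by (simp add: free_generating_set_def)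

lemma reduced_words_carrier: "w \<in> reduced_words B \<Longrightarrow> fst ` set w \<subseteq> carrier G"
  using basis_subset by (auto simp: reduced_words_def)

lemma value_closed: "w \<in> reduced_words B \<Longrightarrow> word_value G w \<in> carrier G"
  by (intro word_value_closed reduced_words_carrier)

lemma nf_word_value: "w \<in> reduced_words B \<Longrightarrow> nf (word_value G w) = w"
  unfolding nf_def using bij_word_value by (intro the_inv_into_f_f) (auto simp: bij_betw_def)

lemma word_value_nf: "x \<in> carrier G \<Longrightarrow> word_value G (nf x) = x"
  unfolding nf_def using bij_word_value by (intro f_the_inv_into_f) (auto simp: bij_betw_def)

lemma nf_in: "x \<in> carrier G \<Longrightarrow> nf x \<in> reduced_words B"
  unfolding nf_def using bij_word_value by (intro the_inv_into_into) (auto simp: bij_betw_def)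

lemma reduced_length_eq: "reduced_length G B x = length (nf x)"
  by (simp add: reduced_length_def nf_def)

lemma nf_inj: "x \<in> carrier G \<Longrightarrow> y \<in> carrier G \<Longrightarrow> nf x = nf y \<Longrightarrow> x = y"
  using word_value_nf by metis

lemma nf_one [simp]: "nf \<one> = []"
  using nf_word_value[of "[]"] by simp

lemma nf_basis: "b \<in> B \<Longrightarrow> nf b = [(b, True)]"
  using nf_word_value[of "[(b, True)]"] basis_subset
  by (auto simp: reduced_words_def word_value_Cons)

lemma nf_inv: "x \<in> carrier G \<Longrightarrow> nf (inv x) = inv_word (nf x)"
  by (metis nf_in nf_word_value reduced_words_carrier reduced_words_inv_word word_value_inv_word
      word_value_nf)

text \<open>Take for \<open>c\<close> the longest common prefix of \<open>inv_word (nf x)\<close>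
  and \<open>nf y\<close>. Since it cannot be extended, nothing cancels where \<open>a\<close> meets
  \<open>b\<close>, so \<open>a @ b\<close> is reduced and uniqueness makes it the normal form of
  the product.\<close>

lemma nf_mult:
  assumes "x \<in> carrier G" "y \<in> carrier G"
  obtains a c b where "nf x = a @ inv_word c" "nf y = c @ b" "nf (x \<otimes> y) = a @ b"
proof -
  obtain c a' b where d: "inv_word (nf x) = c @ a'" "nf y = c @ b"
    "a' \<noteq> [] \<Longrightarrow> b \<noteq> [] \<Longrightarrow> hd a' \<noteq> hd b"
    using common_prefix_decomposition[of "inv_word (nf x)" "nf y"] by metis
  define a where "a = inv_word a'"
  have x: "nf x = a @ inv_word c"
    by (metis a_def d(1) inv_word_append inv_word_inv_word)
  have ra: "fst ` set a \<subseteq> B" "fst ` set c \<subseteq> B" "fst ` set b \<subseteq> B" "reduced a" "reduced b"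
    using nf_in[OF assms(1)] nf_in[OF assms(2)]
    by (auto simp: x d(2) reduced_words_def reduced_append_iff)
  have "hd b \<noteq> apsnd Not (last a)" if "a \<noteq> []" "b \<noteq> []"
  proof -
    have "a' \<noteq> []" using that(1) by (auto simp: a_def)
    moreover have "hd a' = apsnd Not (last a)"
      using \<open>a' \<noteq> []\<close> by (cases a'; cases "hd a'") (auto simp: a_def inv_word_def)
    ultimately show ?thesis using d(3) that by simp
  qed
  then have red: "a @ b \<in> reduced_words B"
    using ra by (auto simp: reduced_words_def reduced_append_iff)
  have "word_value G (a @ b) = word_value G (nf x) \<otimes> word_value G (nf y)"
    unfolding x d(2) using ra basis_subset by (intro word_value_cancel[symmetric]) auto
  then have "nf (x \<otimes> y) = a @ b"
    using nf_word_value[OF red] assms by (simp add: word_value_nf)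
  with x d(2) show ?thesis using that by blast
qed

lemma length_nf_mult:
  assumes "x \<in> carrier G" "y \<in> carrier G"
  shows "length (nf (x \<otimes> y)) \<le> length (nf x) + length (nf y)"
  by (rule nf_mult[OF assms]) auto

text \<open>Subadditivity of length, applied letter by letter. With \<open>S\<close> a second free
  generating set, it bounds lengths over \<open>B\<close> linearly by lengths over \<open>S\<close>,
  which gives the constant \<open>C\<close> of the first part.\<close>

lemma length_nf_word_value:
  assumes "fst ` set w \<subseteq> S" "S \<subseteq> carrier G" "\<And>x. x \<in> S \<Longrightarrow> length (nf x) \<le> C"
  shows "length (nf (word_value G w)) \<le> C * length w"
  using assms(1)
proof (induction w)
  case (Cons x w)
  obtain a s where x: "x = (a, s)" by (cases x)
  define y where "y = (if s then a else inv a)"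
  have a: "a \<in> S" and w: "fst ` set w \<subseteq> carrier G"
    using Cons.prems assms(2) by (auto simp: x)
  have y: "y \<in> carrier G" "length (nf y) \<le> C"
    using a assms(2,3) by (auto simp: y_def nf_inv)
  have "length (nf (word_value G (x # w))) \<le> length (nf y) + length (nf (word_value G w))"
    unfolding x word_value_Cons y_def[symmetric]
    using y word_value_closed[OF w] by (intro length_nf_mult)
  with Cons y show ?case by auto
qed simp

text \<open>The sign is an argument so that a letter \<open>(i, s)\<close> can be matched with the
  factor that it contributes to a product.\<close>

definition signed_nf :: "'a \<Rightarrow> bool \<Rightarrow> 'a word" where
  "signed_nf x s = (if s then nf x else inv_word (nf x))"

lemma length_signed_nf [simp]: "length (signed_nf x s) = length (nf x)"
  by (simp add: signed_nf_def)

lemma inv_word_signed_nf: "inv_word (signed_nf x s) = signed_nf x (\<not> s)"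
  by (simp add: signed_nf_def)

lemma signed_nf_inj:
  "x \<in> carrier G \<Longrightarrow> y \<in> carrier G \<Longrightarrow> signed_nf x s = signed_nf y s \<Longrightarrow> x = y"
  by (auto simp: signed_nf_def dest: nf_inj split: if_splits)

lemma signed_nf_in: "x \<in> carrier G \<Longrightarrow> signed_nf x s \<in> reduced_words B"
  by (simp add: signed_nf_def nf_in)

text \<open>Induction on \<open>w\<close>, peeling off its first letter. The claim on prefixes
  carries the induction: it tells how the value of the tail begins, hence that fewer than
  \<open>d\<close> letters cancel. A factor of length at least \<open>3 * d\<close> then keeps at
  least \<open>2 * d\<close> letters, enough to preserve its prefix and to exceed the loss in the
  tail by \<open>d\<close>.\<close>

lemma nf_word_value_small_cancellation:
  fixes h :: "'i \<Rightarrow> 'a"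
  assumes h: "\<And>i. i \<in> I \<Longrightarrow> h i \<in> carrier G"
    and long: "\<And>i. i \<in> I \<Longrightarrow> 3 * d \<le> length (nf (h i))"
    and prefixes: "\<And>i j s t. i \<in> I \<Longrightarrow> j \<in> I \<Longrightarrow> (i, s) \<noteq> (j, t) \<Longrightarrow>
      take d (signed_nf (h i) s) \<noteq> take d (signed_nf (h j) t)"
    and w: "w \<in> reduced_words I"
  shows "length w * d \<le> length (nf (word_value G (map (map_prod h id) w))) \<and>
    (w \<noteq> [] \<longrightarrow> take d (nf (word_value G (map (map_prod h id) w))) =
       take d (signed_nf (h (fst (hd w))) (snd (hd w))))"
  using w
proof (induction w)
  case (Cons x w)
  obtain i s where x: "x = (i, s)" by (cases x)
  have i: "i \<in> I" and w: "w \<in> reduced_words I"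
    and red: "w \<noteq> [] \<Longrightarrow> hd w \<noteq> (i, \<not> s)"
    using Cons.prems by (auto simp: x reduced_words_def reduced_Cons_iff)
  define y where "y = (if s then h i else inv (h i))"
  define z where "z = word_value G (map (map_prod h id) w)"
  have y: "y \<in> carrier G" and nf_y: "nf y = signed_nf (h i) s"
    using h[OF i] by (auto simp: y_def nf_inv signed_nf_def)
  have z: "z \<in> carrier G"
    unfolding z_def using w h by (intro word_value_closed) (auto simp: reduced_words_def)
  have val: "word_value G (map (map_prod h id) (x # w)) = y \<otimes> z"
    by (simp add: x y_def z_def word_value_Cons)
  have IH: "length w * d \<le> length (nf z)"
    "w \<noteq> [] \<Longrightarrow> take d (nf z) = take d (signed_nf (h (fst (hd w))) (snd (hd w)))"
    using Cons.IH[OF w] unfolding z_def by blast+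
  show ?case
  proof (cases "w = []")
    case True
    then have "z = \<one>" by (simp add: z_def)
    then show ?thesis
      unfolding val using y nf_y long[OF i] True by (simp add: x)
  next
    case False
    obtain j t where jt: "hd w = (j, t)" by (cases "hd w")
    have j: "j \<in> I" using w False jt by (cases w) (auto simp: reduced_words_def)
    obtain a c b where abc: "nf y = a @ inv_word c" "nf z = c @ b" "nf (y \<otimes> z) = a @ b"
      using nf_mult[OF y z] .
    \<comment> \<open>Since \<open>x # w\<close> is reduced, the first letter of \<open>w\<close> is
      not \<open>(i, \<not> s)\<close>, so the hypothesis on prefixes applies to these two
      letters.\<close>
    have "take d (signed_nf (h i) (\<not> s)) \<noteq> take d (nf z)"
      using IH(2)[OF False] prefixes[OF i j, of "\<not> s" t] red[OF False] jt by auto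
    moreover have "signed_nf (h i) (\<not> s) = c @ inv_word a"
      by (metis abc(1) inv_word_append inv_word_inv_word inv_word_signed_nf nf_y)
    \<comment> \<open>Both words start with \<open>c\<close>; if \<open>c\<close> had at least
      \<open>d\<close> letters, their prefixes of length \<open>d\<close> would coincide.\<close>
    ultimately have c: "length c < d"
      using abc(2) by (cases "length c < d") auto
    have len: "length a + length c = length (nf (h i))"
      using arg_cong[OF abc(1), of length] by (simp add: nf_y)
    then have a: "2 * d \<le> length a" using long[OF i] c by linarith
    have "take d (nf (y \<otimes> z)) = take d (nf y)" using a by (simp add: abc)
    moreover have "length (x # w) * d \<le> length (nf (y \<otimes> z))"
      using IH(1) a c abc(2,3) by simp
    ultimately show ?thesis unfolding val by (simp add: x nf_y)
  qed
qed simp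

text \<open>The universal property, to be proved because freeness is defined by normal forms.
  Substituting into \<open>nf x\<close> is multiplicative: by \<open>nf_mult\<close>, the normal
  form of a product arises by deleting one block \<open>inv_word c @ c\<close>, whose image also
  cancels in \<open>H\<close>.\<close>

lemma hom_extension:
  fixes H :: "('h, 'm) monoid_scheme"
  assumes H: "group H" and f: "\<And>b. b \<in> B \<Longrightarrow> f b \<in> carrier H"
  obtains \<phi> where "\<phi> \<in> hom G H" "\<And>b. b \<in> B \<Longrightarrow> \<phi> b = f b"
proof -
  interpret H: group H by (fact H)
  define V where "V w = word_value H (map (map_prod f id) w)" for w
  have car: "fst ` set (map (map_prod f id) w) \<subseteq> carrier H" if "fst ` set w \<subseteq> B" for w
    using that f by fastforce
  have "(\<lambda>x. V (nf x)) \<in> hom G H"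
  proof (rule homI)
    fix x assume "x \<in> carrier G"
    then show "V (nf x) \<in> carrier H"
      unfolding V_def using nf_in by (intro H.word_value_closed car) (auto simp: reduced_words_def)
  next
    fix x y assume xy: "x \<in> carrier G" "y \<in> carrier G"
    obtain a c b where abc: "nf x = a @ inv_word c" "nf y = c @ b" "nf (x \<otimes> y) = a @ b"
      using nf_mult[OF xy] .
    have "fst ` set a \<subseteq> B" "fst ` set c \<subseteq> B" "fst ` set b \<subseteq> B"
      using nf_in[OF xy(1)] nf_in[OF xy(2)] by (auto simp: abc reduced_words_def)
    from this[THEN car] show "V (nf (x \<otimes> y)) = V (nf x) \<otimes>\<^bsub>H\<^esub> V (nf y)"
      unfolding abc V_def map_append map_inv_word by (intro H.word_value_cancel[symmetric])
  qed
  moreover have "V (nf b) = f b" if "b \<in> B" for b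
    using f[OF that] that by (simp add: V_def nf_basis H.word_value_Cons)
  ultimately show ?thesis using that by blast
qed

end

section \<open>Counting\<close>

lemma finite_tuples: "finite A \<Longrightarrow> finite (tuples l A)"
  unfolding tuples_def by (rule finite_lists_length_eq)

lemma card_tuples: "finite A \<Longrightarrow> card (tuples l A) = card A ^ l"
  unfolding tuples_def by (rule card_lists_length_eq)

text \<open>Group the tuples by what remains after deleting entry \<open>i\<close>. There are
  \<open>card A ^ l\<close> possible remainders, and each group is counted by its entry
  \<open>i\<close> alone.\<close>

lemma card_tuples_fibre_bound:
  assumes A: "finite A" and i: "i \<le> l"
    and M: "\<And>xs. xs \<in> tuples (Suc l) A \<Longrightarrow> card {y \<in> A. xs[i := y] \<in> T} \<le> M"
  shows "card (T \<inter> tuples (Suc l) A) \<le> M * card A ^ l"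
proof -
  let ?del = "\<lambda>xs. take i xs @ drop (Suc i) xs"
  have fib: "card {xs \<in> T \<inter> tuples (Suc l) A. ?del xs = ys} \<le> M" for ys
  proof (cases "{xs \<in> T \<inter> tuples (Suc l) A. ?del xs = ys} = {}")
    case False
    then obtain xs0 where xs0: "xs0 \<in> tuples (Suc l) A" "?del xs0 = ys" by auto
    have len: "length xs0 = Suc l" using xs0 by (simp add: tuples_def)
    \<comment> \<open>A fixed member \<open>xs0\<close> parametrizes its whole fibre: any other
      member differs from it at most in entry \<open>i\<close>.\<close>
    have upd: "xs = xs0[i := xs ! i]" "xs ! i \<in> A"
      if xs: "xs \<in> tuples (Suc l) A" "?del xs = ys" for xs
    proof -
      have l: "length xs = Suc l" "set xs \<subseteq> A" using xs by (auto simp: tuples_def)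
      have eq: "take i xs = take i xs0 \<and> drop (Suc i) xs = drop (Suc i) xs0"
        using xs(2) xs0(2) l len i by (subst append_eq_append_conv[symmetric]) auto
      have "xs = take i xs @ xs ! i # drop (Suc i) xs"
        using l i by (intro id_take_nth_drop) simp
      also have "\<dots> = xs0[i := xs ! i]"
        using eq len i by (simp add: upd_conv_take_nth_drop)
      finally show "xs = xs0[i := xs ! i]" .
      show "xs ! i \<in> A" using l i by auto
    qed
    let ?F = "{xs \<in> T \<inter> tuples (Suc l) A. ?del xs = ys}"
    have "?F \<subseteq> (\<lambda>y. xs0[i := y]) ` {y \<in> A. xs0[i := y] \<in> T}"
    proof
      fix xs assume "xs \<in> ?F"
      then have "xs \<in> T" "xs \<in> tuples (Suc l) A" "?del xs = ys" by auto
      with upd[of xs] show "xs \<in> (\<lambda>y. xs0[i := y]) ` {y \<in> A. xs0[i := y] \<in> T}"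
        by (intro image_eqI[where x = "xs ! i"]) auto
    qed
    then have "card ?F \<le> card {y \<in> A. xs0[i := y] \<in> T}"
      using A by (intro surj_card_le) auto
    with M[OF xs0(1)] show ?thesis by simp
  next
    case True
    then show ?thesis by (metis card.empty le0)
  qed
  have img: "?del ` (T \<inter> tuples (Suc l) A) \<subseteq> tuples l A"
    using i by (fastforce simp: tuples_def dest: in_set_takeD in_set_dropD)
  have "card (T \<inter> tuples (Suc l) A) =
      card (\<Union>ys \<in> tuples l A. {xs \<in> T \<inter> tuples (Suc l) A. ?del xs = ys})"
    using img by (intro arg_cong[where f = card]) auto
  also have "\<dots> \<le> (\<Sum>ys \<in> tuples l A. card {xs \<in> T \<inter> tuples (Suc l) A. ?del xs = ys})"
    by (intro card_UN_le finite_tuples A)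
  also have "\<dots> \<le> (\<Sum>ys \<in> tuples l A. M)" by (intro sum_mono fib)
  finally show ?thesis by (simp add: card_tuples A mult.commute)
qed

section \<open>Exponential growth of balls\<close>

locale finite_free_basis = free_basis +
  assumes finite_basis: "finite B" and rank: "card B > 1"
begin

definition ball_size :: "nat \<Rightarrow> nat" where
  "ball_size p = card (word_ball G B p)"

lemma word_ball_iff: "x \<in> word_ball G B p \<longleftrightarrow> x \<in> carrier G \<and> length (nf x) \<le> p"
  by (simp add: word_ball_def reduced_length_eq)

lemma finite_short_words: "finite {w \<in> reduced_words B. length w \<le> p}"
  by (rule finite_subset[OF _ finite_lists_length_le[of "B \<times> UNIV" p]])
    (use finite_basis in \<open>auto simp: reduced_words_def\<close>)

lemma bij_nf_word_ball: "bij_betw nf (word_ball G B p) {w \<in> reduced_words B. length w \<le> p}"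
  by (rule bij_betw_byWitness[where f' = "word_value G"])
    (auto simp: word_ball_iff word_value_nf nf_word_value nf_in value_closed)

lemma finite_word_ball: "finite (word_ball G B p)"
  using bij_betw_finite[OF bij_nf_word_ball] finite_short_words by blast

lemma ball_size_eq: "ball_size p = card {w \<in> reduced_words B. length w \<le> p}"
  unfolding ball_size_def by (rule bij_betw_same_card[OF bij_nf_word_ball])

lemma ball_size_pos: "ball_size p > 0"
proof -
  have "\<one> \<in> word_ball G B p" by (simp add: word_ball_iff)
  then show ?thesis using finite_word_ball by (auto simp: ball_size_def card_gt_0_iff)
qed

text \<open>The common form of the counts below: exceptional elements are encoded injectively by
  shorter reduced words.\<close>

lemma card_le_ball_size:
  assumes "inj_on f S" "\<And>x. x \<in> S \<Longrightarrow> f x \<in> reduced_words B" "\<And>x. x \<in> S \<Longrightarrow> length (f x) \<le> p"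
  shows "card S \<le> ball_size p"
  unfolding ball_size_eq using assms
  by (intro card_inj_on_le[of f] finite_short_words) auto

text \<open>Every reduced word can be extended to the left by each generator, with a suitable sign.\<close>

lemma ball_size_Suc: "2 * ball_size p \<le> ball_size (Suc p)"
proof -
  have "\<not> (\<forall>x\<in>B. \<forall>y\<in>B. x = y)"
    unfolding card_le_Suc0_iff_eq[OF finite_basis, symmetric] using rank by simp
  then obtain b1 b2 where b: "b1 \<in> B" "b2 \<in> B" "b1 \<noteq> b2" by blast
  define e :: "'a \<Rightarrow> 'a word \<Rightarrow> 'a word"
    where "e b w = (b, w = [] \<or> hd w \<noteq> (b, False)) # w" for b w
  have e: "e b w \<in> reduced_words B" if "b \<in> B" "w \<in> reduced_words B" for b w
  proof -
    have "hd w \<noteq> (b, \<not> (w = [] \<or> hd w \<noteq> (b, False)))" if "w \<noteq> []"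
      by (cases "hd w = (b, False)") (use that in auto)
    then show ?thesis using that by (simp add: e_def reduced_words_def reduced_Cons_iff)
  qed
  let ?R = "\<lambda>p. {w \<in> reduced_words B. length w \<le> p}"
  have c: "card (e b ` ?R p) = ball_size p" for b
    unfolding ball_size_eq by (intro card_image inj_onI) (simp add: e_def)
  have "e b1 ` ?R p \<inter> e b2 ` ?R p = {}"
    using b(3) by (auto simp: e_def)
  then have "2 * ball_size p = card (e b1 ` ?R p \<union> e b2 ` ?R p)"
    by (simp add: card_Un_disjoint finite_short_words c)
  also have "\<dots> \<le> ball_size (Suc p)"
    unfolding ball_size_eq using b e
    by (intro card_mono finite_short_words) (auto simp: e_def)
  finally show ?thesis .
qed

lemma ball_size_add: "2 ^ d * ball_size p \<le> ball_size (p + d)"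
proof (induction d)
  case (Suc d)
  have "2 ^ Suc d * ball_size p \<le> 2 * ball_size (p + d)" using Suc by simp
  also have "\<dots> \<le> ball_size (p + Suc d)" using ball_size_Suc by simp
  finally show ?case .
qed simp

text \<open>Reducing the radius by \<open>p div 4\<close> divides the size of the ball by at least
  \<open>2 ^ (p div 4)\<close>, and this exponent tends to infinity.\<close>

lemma ball_size_ratio: "(\<lambda>p. real (ball_size (p - p div 4)) / real (ball_size p)) \<longlonglongrightarrow> 0"
proof (rule tendsto_sandwich[OF _ _ tendsto_const])
  show "\<forall>\<^sub>F p in sequentially. real (ball_size (p - p div 4)) / real (ball_size p) \<le> (1 / 2) ^ (p div 4)"
  proof (intro always_eventually allI)
    fix p :: nat
    have "2 ^ (p div 4) * ball_size (p - p div 4) \<le> ball_size p"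
      using ball_size_add[of "p div 4" "p - p div 4"] by simp
    then have "2 ^ (p div 4) * real (ball_size (p - p div 4)) \<le> real (ball_size p)"
      by (metis of_nat_le_iff of_nat_mult of_nat_numeral of_nat_power)
    then show "real (ball_size (p - p div 4)) / real (ball_size p) \<le> (1 / 2) ^ (p div 4)"
      using ball_size_pos[of p] by (simp add: field_simps)
  qed
  have "filterlim (\<lambda>p::nat. p div 4) at_top at_top"
    unfolding filterlim_at_top
  proof
    fix Z :: nat
    show "\<forall>\<^sub>F p in at_top. Z \<le> p div 4"
      using eventually_ge_at_top[of "4 * Z"] by eventually_elim simp
  qed
  then show "(\<lambda>p::nat. (1 / 2 :: real) ^ (p div 4)) \<longlonglongrightarrow> 0"
    by (rule filterlim_compose[rotated]) (rule LIMSEQ_power_zero, simp)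
qed simp

text \<open>With \<open>d = p div 4\<close> one has \<open>3 * d \<le> p - d\<close>, so the short
  elements already lie in the ball of radius \<open>p - d\<close>.\<close>

lemma card_short: "card {y \<in> word_ball G B p. length (nf y) < 3 * (p div 4)} \<le> ball_size (p - p div 4)"
  by (rule card_le_ball_size[of nf]) (auto simp: word_ball_iff nf_in intro!: inj_onI dest: nf_inj)

text \<open>Once the first \<open>d\<close> letters are prescribed, the at most \<open>p - d\<close>
  remaining letters determine the element.\<close>

lemma card_prefix:
  "card {y \<in> word_ball G B p. take d (signed_nf y s) = a} \<le> ball_size (p - d)"
proof (rule card_le_ball_size[of "\<lambda>y. drop d (signed_nf y s)"])
  show "inj_on (\<lambda>y. drop d (signed_nf y s)) {y \<in> word_ball G B p. take d (signed_nf y s) = a}"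
  proof (rule inj_onI)
    fix x y
    assume x: "x \<in> {y \<in> word_ball G B p. take d (signed_nf y s) = a}"
      and y: "y \<in> {y \<in> word_ball G B p. take d (signed_nf y s) = a}"
      and eq: "drop d (signed_nf x s) = drop d (signed_nf y s)"
    have "signed_nf x s = signed_nf y s"
      using x y eq append_take_drop_id[of d "signed_nf x s"] append_take_drop_id[of d "signed_nf y s"]
      by simp
    then show "x = y" using x y signed_nf_inj by (auto simp: word_ball_iff)
  qed
qed (auto simp: word_ball_iff signed_nf_in intro!: drop_in_reduced_words)

text \<open>The last \<open>d\<close> letters of such a word determine its first \<open>d\<close> letters.\<close>

lemma card_self_prefix:
  "card {y \<in> word_ball G B p. 3 * d \<le> length (nf y) \<and> take d (nf y) = take d (inv_word (nf y))}
    \<le> ball_size (p - d)" (is "card ?S \<le> _")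
proof (rule card_le_ball_size[of "\<lambda>y. drop d (nf y)"])
  have *: "nf y = take d (inv_word (drop d (nf y))) @ drop d (nf y)" if y: "y \<in> ?S" for y
  proof -
    have "inv_word (nf y) = inv_word (drop d (nf y)) @ inv_word (take d (nf y))"
      by (simp flip: inv_word_append)
    \<comment> \<open>The length bound keeps the first and the last \<open>d\<close> letters apart,
      so the last ones lie entirely in the tail.\<close>
    moreover have "d \<le> length (drop d (nf y))" using y by auto
    ultimately have "take d (nf y) = take d (inv_word (drop d (nf y)))" using y by simp
    then show ?thesis by (metis append_take_drop_id)
  qed
  show "inj_on (\<lambda>y. drop d (nf y)) ?S"
  proof (rule inj_onI)
    fix x y assume xy: "x \<in> ?S" "y \<in> ?S" "drop d (nf x) = drop d (nf y)"
    have "nf x = nf y" using *[OF xy(1)] *[OF xy(2)] xy(3) by simp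
    then show "x = y" using xy nf_inj by (auto simp: word_ball_iff)
  qed
qed (auto simp: word_ball_iff nf_in intro!: drop_in_reduced_words)

section \<open>Negligible families of sets of tuples\<close>

text \<open>A family indexed by the radius rather than a single set, because the exceptional
  conditions involve \<open>p div 4\<close>.\<close>

definition negligible :: "nat \<Rightarrow> (nat \<Rightarrow> 'a list set) \<Rightarrow> bool" where
  "negligible l T \<longleftrightarrow>
     (\<lambda>p. real (card (T p \<inter> tuples l (word_ball G B p))) / real (card (tuples l (word_ball G B p))))
       \<longlonglongrightarrow> 0"

text \<open>The inclusion is required only for large \<open>p\<close> and inside the ball, since the
  estimate on lengths holds only there.\<close>

lemma negligible_mono:
  assumes "negligible l T"
    and "\<forall>\<^sub>F p in sequentially. S p \<inter> tuples l (word_ball G B p) \<subseteq> T p"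
  shows "negligible l S"
  unfolding negligible_def
proof (rule tendsto_sandwich[OF _ _ tendsto_const assms(1)[unfolded negligible_def]])
  show "\<forall>\<^sub>F p in sequentially.
      real (card (S p \<inter> tuples l (word_ball G B p))) / real (card (tuples l (word_ball G B p)))
      \<le> real (card (T p \<inter> tuples l (word_ball G B p))) / real (card (tuples l (word_ball G B p)))"
    using assms(2)
    by eventually_elim
      (intro divide_right_mono of_nat_mono card_mono finite_Int disjI2 finite_tuples
        finite_word_ball, auto)
qed simp

lemma negligible_empty: "negligible l (\<lambda>p. {})"
  by (simp add: negligible_def)

lemma negligible_Un:
  assumes "negligible l S" "negligible l T"
  shows "negligible l (\<lambda>p. S p \<union> T p)"
  unfolding negligible_def
proof (rule tendsto_sandwich[OF _ _ tendsto_const])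
  show "\<forall>\<^sub>F p in sequentially.
      real (card ((S p \<union> T p) \<inter> tuples l (word_ball G B p))) / real (card (tuples l (word_ball G B p)))
      \<le> real (card (S p \<inter> tuples l (word_ball G B p))) / real (card (tuples l (word_ball G B p)))
        + real (card (T p \<inter> tuples l (word_ball G B p))) / real (card (tuples l (word_ball G B p)))"
    unfolding add_divide_distrib[symmetric] Int_Un_distrib2 of_nat_add[symmetric]
    by (intro always_eventually allI divide_right_mono of_nat_mono card_Un_le) simp
qed (use tendsto_add[OF assms[unfolded negligible_def]] in simp_all)

lemma negligible_UN:
  assumes "finite I" "\<And>i. i \<in> I \<Longrightarrow> negligible l (T i)"
  shows "negligible l (\<lambda>p. \<Union>i\<in>I. T i p)"
  using assms by (induction I) (auto simp: negligible_empty negligible_Un)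

lemma negligible_coordinate:
  assumes "i \<le> l"
    and "\<And>p xs. xs \<in> tuples (Suc l) (word_ball G B p) \<Longrightarrow>
      card {y \<in> word_ball G B p. xs[i := y] \<in> T p} \<le> ball_size (p - p div 4)"
  shows "negligible (Suc l) T"
  unfolding negligible_def
proof (rule tendsto_sandwich[OF _ _ tendsto_const ball_size_ratio])
  show "\<forall>\<^sub>F p in sequentially.
      real (card (T p \<inter> tuples (Suc l) (word_ball G B p))) / real (card (tuples (Suc l) (word_ball G B p)))
      \<le> real (ball_size (p - p div 4)) / real (ball_size p)"
  proof (intro always_eventually allI)
    fix p
    have "card (T p \<inter> tuples (Suc l) (word_ball G B p)) \<le> ball_size (p - p div 4) * ball_size p ^ l"
      unfolding ball_size_def[of p]
      using assms by (intro card_tuples_fibre_bound finite_word_ball) auto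
    then have "real (card (T p \<inter> tuples (Suc l) (word_ball G B p)))
        \<le> real (ball_size (p - p div 4)) * real (ball_size p) ^ l"
      by (metis of_nat_le_iff of_nat_mult of_nat_power)
    then show "real (card (T p \<inter> tuples (Suc l) (word_ball G B p))) /
        real (card (tuples (Suc l) (word_ball G B p)))
      \<le> real (ball_size (p - p div 4)) / real (ball_size p)"
      using ball_size_pos[of p]
      by (simp add: card_tuples finite_word_ball field_simps flip: ball_size_def)
  qed
qed simp

text \<open>Elements of the domain are represented by words over the indices \<open>{..<n}\<close>,
  so that the tuple alone determines their images. Only the linear growth of \<open>g\<close>
  matters, which lets one statement cover both parts.\<close>

lemma negligible_twisted:
  fixes g :: "nat word \<Rightarrow> 'a"
  assumes g: "\<And>w. w \<in> reduced_words {..<n} \<Longrightarrow> g w \<in> carrier G"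
    and C: "\<And>w. w \<in> reduced_words {..<n} \<Longrightarrow> length (nf (g w)) \<le> C * length w"
  shows "negligible (n + 2) (\<lambda>p. {xs. \<exists>w \<in> reduced_words {..<n}.
    xs ! n = word_value G (map (map_prod (nth xs) id) w) \<otimes> xs ! (n + 1) \<otimes> inv (g w)})"
proof -
  define Eq :: "nat word \<Rightarrow> nat \<Rightarrow> 'a list set" where "Eq w p = {xs.
    xs ! n = word_value G (map (map_prod (nth xs) id) w) \<otimes> xs ! (n + 1) \<otimes> inv (g w)}" for w p
  define Short :: "nat \<Rightarrow> nat \<Rightarrow> 'a list set"
    where "Short i p = {xs. length (nf (xs ! i)) < 3 * (p div 4)}" for i p
  \<comment> \<open>The length bound is the one that \<open>card_self_prefix\<close> needs; shorter
    entries fall under \<open>Short\<close>.\<close>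
  define Self :: "nat \<Rightarrow> nat \<Rightarrow> 'a list set"
    where "Self i p = {xs. 3 * (p div 4) \<le> length (nf (xs ! i)) \<and>
    take (p div 4) (nf (xs ! i)) = take (p div 4) (inv_word (nf (xs ! i)))}" for i p
  define Pair :: "(nat \<times> bool) \<times> (nat \<times> bool) \<Rightarrow> nat \<Rightarrow> 'a list set"
    where "Pair = (\<lambda>((i, s), (j, t)) p. {xs.
      take (p div 4) (signed_nf (xs ! i) s) = take (p div 4) (signed_nf (xs ! j) t)})"
  \<comment> \<open>The bound 18 comes from the final estimate: a solution \<open>w\<close> outside
    the other exceptional sets satisfies \<open>length w * d \<le> 16 * d + 12 < 19 * d\<close> for
    large \<open>p\<close>, where \<open>d = p div 4\<close>.\<close>
  define W where "W = {w \<in> reduced_words {..<n}. length w \<le> 18}"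
  \<comment> \<open>Equal indices are left out, since changing entry \<open>i\<close> would then
    alter both prefixes. The one such case that is needed, with opposite signs, is
    \<open>Self\<close>.\<close>
  define P :: "((nat \<times> bool) \<times> (nat \<times> bool)) set"
    where "P = {((i, s), (j, t)) | i s j t. i < n \<and> j < n \<and> i \<noteq> j}"
  have finW: "finite W"
    by (rule finite_subset[OF _ finite_lists_length_le[of "{..<n} \<times> UNIV" 18]])
      (auto simp: W_def reduced_words_def)
  have finP: "finite P"
    by (rule finite_subset[of _ "({..<n} \<times> UNIV) \<times> ({..<n} \<times> UNIV)"]) (auto simp: P_def)
  have negEq: "negligible (n + 2) (Eq w)" if "w \<in> W" for w
  proof -
    have "card {y \<in> word_ball G B p. xs[n := y] \<in> Eq w p} \<le> ball_size (p - p div 4)"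
      if xs: "xs \<in> tuples (n + 2) (word_ball G B p)" for p xs
    proof -
      \<comment> \<open>The letters of \<open>w\<close> are indices below \<open>n\<close>, so the
        right-hand side of the equation does not depend on entry \<open>n\<close> and leaves at most
        one value for it.\<close>
      have *: "map (map_prod (nth (xs[n := y])) id) w = map (map_prod (nth xs) id) w" for y
        using \<open>w \<in> W\<close> by (intro map_cong refl) (auto simp: W_def reduced_words_def)
      have "{y \<in> word_ball G B p. xs[n := y] \<in> Eq w p} \<subseteq>
          {word_value G (map (map_prod (nth xs) id) w) \<otimes> xs ! (n + 1) \<otimes> inv (g w)}"
        using xs unfolding Eq_def mem_Collect_eq * by (auto simp: tuples_def)
      from card_mono[OF _ this] have "card {y \<in> word_ball G B p. xs[n := y] \<in> Eq w p} \<le> 1"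
        by simp
      also have "1 \<le> ball_size (p - p div 4)" using ball_size_pos by (simp add: Suc_leI)
      finally show ?thesis .
    qed
    then show ?thesis using negligible_coordinate[of n "n + 1" "Eq w"] by simp
  qed
  have negShort: "negligible (n + 2) (Short i)" if "i < n" for i
  proof -
    have "card {y \<in> word_ball G B p. xs[i := y] \<in> Short i p} \<le> ball_size (p - p div 4)"
      if "xs \<in> tuples (n + 2) (word_ball G B p)" for p xs
      using that card_short[of p] \<open>i < n\<close> by (simp add: Short_def tuples_def)
    then show ?thesis using negligible_coordinate[of i "n + 1" "Short i"] that by simp
  qed
  have negSelf: "negligible (n + 2) (Self i)" if "i < n" for i
  proof -
    have "card {y \<in> word_ball G B p. xs[i := y] \<in> Self i p} \<le> ball_size (p - p div 4)"
      if "xs \<in> tuples (n + 2) (word_ball G B p)" for p xs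
      using that card_self_prefix[of p "p div 4"] \<open>i < n\<close> by (simp add: Self_def tuples_def)
    then show ?thesis using negligible_coordinate[of i "n + 1" "Self i"] that by simp
  qed
  have negPair: "negligible (n + 2) (Pair q)" if "q \<in> P" for q
  proof -
    obtain i s j t where q: "q = ((i, s), (j, t))" "i < n" "j < n" "i \<noteq> j"
      using \<open>q \<in> P\<close> unfolding P_def by blast
    \<comment> \<open>As \<open>j\<close> differs from \<open>i\<close>, the prefix coming from
      entry \<open>j\<close> stays fixed while entry \<open>i\<close> varies.\<close>
    have "card {y \<in> word_ball G B p. xs[i := y] \<in> Pair q p} \<le> ball_size (p - p div 4)"
      if "xs \<in> tuples (n + 2) (word_ball G B p)" for p xs
      using that q card_prefix[of p "p div 4" s] by (simp add: Pair_def tuples_def)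
    then show ?thesis using negligible_coordinate[of i "n + 1" "Pair q"] q by simp
  qed
  let ?T = "\<lambda>p. (\<Union>w\<in>W. Eq w p) \<union> ((\<Union>i\<in>{..<n}. Short i p) \<union>
    ((\<Union>i\<in>{..<n}. Self i p) \<union> (\<Union>q\<in>P. Pair q p)))"
  have "negligible (n + 2) ?T"
    by (intro negligible_Un negligible_UN finW finP negEq negShort negSelf negPair) auto
  then show ?thesis
  proof (rule negligible_mono)
    show "\<forall>\<^sub>F p in sequentially. {xs. \<exists>w \<in> reduced_words {..<n}.
        xs ! n = word_value G (map (map_prod (nth xs) id) w) \<otimes> xs ! (n + 1) \<otimes> inv (g w)}
        \<inter> tuples (n + 2) (word_ball G B p) \<subseteq> ?T p"
      using eventually_ge_at_top[of "4 * (2 * C + 6)"]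
    proof eventually_elim
      case (elim p)
      define d where "d = p div 4"
      \<comment> \<open>The first bound lets \<open>d\<close> absorb the contribution of
        \<open>g\<close>; the 3 in the second one is the largest remainder modulo 4.\<close>
      have d: "2 * C + 6 \<le> d" "p \<le> 4 * d + 3" using elim by (auto simp: d_def)
      show ?case
      proof (rule subsetI, rule ccontr)
        fix xs
        assume xs: "xs \<in> {xs. \<exists>w \<in> reduced_words {..<n}.
            xs ! n = word_value G (map (map_prod (nth xs) id) w) \<otimes> xs ! (n + 1) \<otimes> inv (g w)}
            \<inter> tuples (n + 2) (word_ball G B p)"
          and not: "xs \<notin> ?T p"
        obtain w where w: "w \<in> reduced_words {..<n}"
          and eq: "xs ! n = word_value G (map (map_prod (nth xs) id) w) \<otimes> xs ! (n + 1) \<otimes> inv (g w)"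
          using xs by auto
        have len: "length xs = n + 2" and ball: "\<And>i. i < n + 2 \<Longrightarrow> xs ! i \<in> word_ball G B p"
          using xs by (auto simp: tuples_def)
        have car: "\<And>i. i < n + 2 \<Longrightarrow> xs ! i \<in> carrier G"
          and le: "\<And>i. i < n + 2 \<Longrightarrow> length (nf (xs ! i)) \<le> p"
          using ball by (auto simp: word_ball_iff)
        have "\<not> length w \<le> 18" using not w eq by (auto simp: W_def Eq_def)
        have long: "3 * d \<le> length (nf (xs ! i))" if "i \<in> {..<n}" for i
          using not that by (auto simp: Short_def d_def not_less)
        have self: "take d (nf (xs ! i)) \<noteq> take d (inv_word (nf (xs ! i)))" if "i \<in> {..<n}" for i
          using not that long[OF that] by (auto simp: Self_def d_def)
        have prefixes: "take d (signed_nf (xs ! i) s) \<noteq> take d (signed_nf (xs ! j) t)"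
          if ij: "i \<in> {..<n}" "j \<in> {..<n}" "(i, s) \<noteq> (j, t)" for i j s t
        proof (cases "i = j")
          case True
          then show ?thesis using self[OF ij(1)] ij(3) by (cases s; cases t) (auto simp: signed_nf_def)
        next
          case False
          then have "((i, s), (j, t)) \<in> P" using ij by (auto simp: P_def)
          then have "xs \<notin> Pair ((i, s), (j, t)) p" using not by blast
          then show ?thesis by (simp add: Pair_def d_def)
        qed
        let ?z = "word_value G (map (map_prod (nth xs) id) w)"
        have z: "?z \<in> carrier G"
          using w car by (intro word_value_closed) (auto simp: reduced_words_def)
        have "length w * d \<le> length (nf ?z)"
          using nf_word_value_small_cancellation[OF _ long prefixes w] car by auto
        \<comment> \<open>Solving the equation for the image of \<open>w\<close> bounds its length
          from above, against the lower bound from small cancellation.\<close>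
        also have "?z = xs ! n \<otimes> (g w \<otimes> inv (xs ! (n + 1)))"
          using z g[OF w] car[of "n + 1"] unfolding eq by (simp add: m_assoc inv_solve_right flip: m_assoc)
            (simp add: m_assoc)
        also have "length (nf \<dots>) \<le> length (nf (xs ! n)) + length (nf (g w \<otimes> inv (xs ! (n + 1))))"
          using g[OF w] car by (intro length_nf_mult) auto
        also have "\<dots> \<le> length (nf (xs ! n)) + (length (nf (g w)) + length (nf (inv (xs ! (n + 1)))))"
          using g[OF w] car by (intro add_left_mono length_nf_mult) auto
        also have "\<dots> \<le> p + (C * length w + p)"
          using C[OF w] le[of n] le[of "n + 1"] car[of "n + 1"] by (simp add: nf_inv)
        finally have 1: "length w * d \<le> 2 * p + C * length w" by simp
        \<comment> \<open>Doubling the bound \<open>1\<close> and absorbing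
          \<open>2 * C * length w\<close> into \<open>d * length w\<close> leaves
          \<open>length w * d \<le> 4 * p\<close>.\<close>
        have "(2 * C + 6) * length w \<le> d * length w" using d(1) by (rule mult_right_mono) simp
        then have "length w * d \<le> 16 * d + 12" using 1 d(2) by (simp add: algebra_simps)
        also have "\<dots> < 19 * d" using d(1) by simp
        finally have "length w < 19" by simp
        with \<open>\<not> length w \<le> 18\<close> show False by simp
      qed
    qed
  qed
qed

lemma generic_if_negligible:
  assumes "S \<subseteq> tuples l (carrier G)" "negligible l (\<lambda>p. tuples l (carrier G) - S)"
  shows "generic G B l S"
  unfolding generic_def has_asymptotic_density_def
proof (intro conjI assms(1))
  let ?t = "\<lambda>p. tuples l (word_ball G B p)"
  have "real (card (S \<inter> ?t p)) / real (card (?t p)) =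
      1 - real (card ((tuples l (carrier G) - S) \<inter> ?t p)) / real (card (?t p))" for p
  proof -
    have fin: "finite (?t p)" by (intro finite_tuples finite_word_ball)
    have pos: "card (?t p) > 0"
      using ball_size_pos[of p] by (simp add: card_tuples finite_word_ball ball_size_def)
    have "(tuples l (carrier G) - S) \<inter> ?t p = ?t p - S"
      by (auto simp: tuples_def word_ball_iff)
    moreover have "card (?t p) = card (S \<inter> ?t p) + card (?t p - S)"
      using fin by (metis Int_commute card_Int_Diff)
    ultimately have "real (card (S \<inter> ?t p)) + real (card ((tuples l (carrier G) - S) \<inter> ?t p)) =
        real (card (?t p))"
      by simp
    then have "real (card (S \<inter> ?t p)) / real (card (?t p)) +
        real (card ((tuples l (carrier G) - S) \<inter> ?t p)) / real (card (?t p)) = 1"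
      using pos by (simp flip: add_divide_distrib)
    then show ?thesis by linarith
  qed
  then show "(\<lambda>p. real (card (S \<inter> ?t p)) / real (card (?t p))) \<longlonglongrightarrow> 1"
    using tendsto_diff[OF tendsto_const[of 1] assms(2)[unfolded negligible_def]] by simp
qed

end

section \<open>From tuples to homomorphisms\<close>

text \<open>Every tuple over the carrier encodes a homomorphism, so a tuple outside the set provides
  a solution \<open>z\<close>. Writing \<open>z\<close> as a reduced word over \<open>as\<close> and
  renaming generators to indices leads to \<open>negligible_twisted\<close>.\<close>

lemma generic_untwisted:
  fixes G :: "('a, 'c) monoid_scheme" and H :: "('b, 'd) monoid_scheme"
  assumes G: "free_generators G as"
    and H: "free_generating_set H B" "finite B" "card B > 1"
    and g: "\<And>z. z \<in> carrier G \<Longrightarrow> g z \<in> carrier H"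
    and C: "\<And>w. w \<in> reduced_words (set as) \<Longrightarrow>
      reduced_length H B (g (word_value G w)) \<le> C * length w"
  shows "generic H B (length as + 2)
    {triple_code as \<phi> u v | \<phi> u v. \<phi> \<in> hom G H \<and> u \<in> carrier H \<and> v \<in> carrier H \<and>
      \<not> (\<exists>z \<in> carrier G. u = \<phi> z \<otimes>\<^bsub>H\<^esub> v \<otimes>\<^bsub>H\<^esub> inv\<^bsub>H\<^esub> g z)}" (is "generic H B _ ?S")
proof -
  interpret G: free_basis G "set as"
    using G by (auto simp: free_basis_def free_basis_axioms_def free_generators_def
        free_generating_set_def)
  interpret H: finite_free_basis H B
    using H by (auto simp: finite_free_basis_def finite_free_basis_axioms_def free_basis_def
        free_basis_axioms_def free_generating_set_def)
  have dist: "distinct as" using G by (simp add: free_generators_def)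
  define n where "n = length as"
  \<comment> \<open>Replaces indices by generators. Because \<open>as\<close> is distinct,
    \<open>r\<close> maps the reduced words over \<open>{..<n}\<close> onto those over
    \<open>set as\<close>.\<close>
  define r where "r w = map (map_prod (nth as) id) w" for w :: "nat word"
  have inj: "inj_on (nth as) {..<n}"
    using dist by (auto simp: n_def inj_on_nth)
  have r: "r w \<in> reduced_words (set as)" if "w \<in> reduced_words {..<n}" for w
  proof -
    have "reduced (r w)"
      unfolding r_def using that inj_on_subset[OF inj]
      by (subst reduced_map) (auto simp: reduced_words_def)
    then show ?thesis using that by (auto simp: r_def reduced_words_def n_def)
  qed
  have r_surj: "\<exists>w \<in> reduced_words {..<n}. r w = v" if v: "v \<in> reduced_words (set as)" for v
  proof -
    have "v \<in> lists (set as \<times> UNIV)" using v by (auto simp: reduced_words_def)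
    also have "set as \<times> UNIV = map_prod (nth as) id ` ({..<n} \<times> (UNIV :: bool set))"
      by (intro map_prod_surj_on[symmetric]) (auto simp: n_def set_conv_nth)
    finally obtain w where w: "w \<in> lists ({..<n} \<times> UNIV)" "v = r w"
      by (auto simp: lists_image r_def)
    then have sub: "fst ` set w \<subseteq> {..<n}" by auto
    have "reduced w"
      using v w inj_on_subset[OF inj sub] by (simp add: reduced_words_def r_def reduced_map)
    then show ?thesis using w sub by (auto simp: reduced_words_def)
  qed
  have "generic H B (n + 2) ?S"
  proof (rule H.generic_if_negligible)
    show "?S \<subseteq> tuples (n + 2) (carrier H)"
      using G.basis_subset by (auto simp: tuples_def triple_code_def n_def hom_def Pi_iff subset_iff)
    have "H.negligible (n + 2) (\<lambda>p. {xs. \<exists>w \<in> reduced_words {..<n}.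
      xs ! n = word_value H (map (map_prod (nth xs) id) w) \<otimes>\<^bsub>H\<^esub> xs ! (n + 1)
        \<otimes>\<^bsub>H\<^esub> inv\<^bsub>H\<^esub> g (word_value G (r w))})"
    proof (intro H.negligible_twisted[where C = C] g G.value_closed r)
      fix w :: "nat word" assume "w \<in> reduced_words {..<n}"
      from C[OF r[OF this]]
      show "length (H.nf (g (word_value G (r w)))) \<le> C * length w"
        by (simp add: H.reduced_length_eq r_def)
    qed
    then show "H.negligible (n + 2) (\<lambda>p. tuples (n + 2) (carrier H) - ?S)"
    proof (rule H.negligible_mono, intro always_eventually allI subsetI)
      fix p xs
      assume "xs \<in> (tuples (n + 2) (carrier H) - ?S) \<inter> tuples (n + 2) (word_ball H B p)"
      then have xs: "set xs \<subseteq> carrier H" "length xs = n + 2" "xs \<notin> ?S"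
        by (auto simp: tuples_def)
      define f where "f b = xs ! the_inv_into {..<n} (nth as) b" for b
      have f: "f (as ! i) = xs ! i" if "i < n" for i
        using that inj by (simp add: f_def the_inv_into_f_f)
      have "f b \<in> carrier H" if "b \<in> set as" for b
      proof -
        obtain i where "i < n" "b = as ! i" using \<open>b \<in> set as\<close> by (auto simp: in_set_conv_nth n_def)
        moreover from this have "xs ! i \<in> set xs" using xs(2) by simp
        ultimately show ?thesis using f xs(1) by auto
      qed
      \<comment> \<open>Freeness of the domain turns the first \<open>n\<close> entries, which are
        arbitrary, into the values of a homomorphism.\<close>
      then obtain \<phi> where \<phi>: "\<phi> \<in> hom G H" "\<And>b. b \<in> set as \<Longrightarrow> \<phi> b = f b"
        using G.hom_extension[OF H.is_group] by blast
      have \<phi>_nth: "\<phi> (as ! i) = xs ! i" if "i < n" for i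
        using \<phi>(2)[of "as ! i"] f that by (simp add: n_def)
      have "xs = triple_code as \<phi> (xs ! n) (xs ! (n + 1))"
        unfolding triple_code_def using \<phi>_nth xs(2)
        by (intro nth_equalityI) (auto simp: n_def nth_append less_Suc_eq)
      moreover have "xs ! n \<in> carrier H" "xs ! (n + 1) \<in> carrier H" using xs by auto
      \<comment> \<open>Since \<open>xs\<close> is the code of a triple, it can lie outside
        \<open>?S\<close> only if the equation has a solution.\<close>
      ultimately have "\<exists>z \<in> carrier G. xs ! n = \<phi> z \<otimes>\<^bsub>H\<^esub> xs ! (n + 1) \<otimes>\<^bsub>H\<^esub> inv\<^bsub>H\<^esub> g z"
        using xs(3) \<phi>(1) unfolding mem_Collect_eq by metis
      then obtain z where z: "z \<in> carrier G"
        "xs ! n = \<phi> z \<otimes>\<^bsub>H\<^esub> xs ! (n + 1) \<otimes>\<^bsub>H\<^esub> inv\<^bsub>H\<^esub> g z"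
        by blast
      obtain w where w: "w \<in> reduced_words {..<n}" "r w = G.nf z"
        using r_surj[OF G.nf_in[OF z(1)]] by blast
      have z_eq: "z = word_value G (r w)" using w G.word_value_nf z by simp
      have "\<phi> z = word_value H (map (map_prod \<phi> id) (r w))"
        unfolding z_eq using r[OF w(1)]
        by (intro hom_word_value G.is_group H.is_group \<phi>(1) G.reduced_words_carrier)
      also have "map (map_prod \<phi> id) (r w) = map (map_prod (nth xs) id) w"
        using w(1) \<phi>_nth by (auto simp: r_def reduced_words_def intro!: map_cong)
      finally have \<phi>_z: "\<phi> z = word_value H (map (map_prod (nth xs) id) w)" .
      show "xs \<in> {xs. \<exists>w \<in> reduced_words {..<n}.
        xs ! n = word_value H (map (map_prod (nth xs) id) w) \<otimes>\<^bsub>H\<^esub> xs ! (n + 1)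
          \<otimes>\<^bsub>H\<^esub> inv\<^bsub>H\<^esub> g (word_value G (r w))}"
        using z(2) by (intro CollectI bexI[OF _ w(1)]) (simp add: \<phi>_z flip: z_eq)
    qed
  qed
  then show ?thesis by (simp add: n_def)
qed

theorem corollary6:
  fixes G :: "('a, 'c) monoid_scheme" and H :: "('b, 'd) monoid_scheme"
    and as :: "'a list" and B :: "'b set"
  assumes "free_generators G as"
    and "free_generating_set H B" and "finite B" and "card B > 1"
  shows "(\<forall>bs. free_generators H bs \<longrightarrow>
           generic H B (length bs + 2)
             {triple_code bs \<phi> u v | \<phi> u v. \<phi> \<in> hom H H \<and> u \<in> carrier H \<and> v \<in> carrier H \<and>
                \<not> twisted_conjugate H \<phi> u v}) \<and>
         generic H B (length as + 2)
           {triple_code as \<phi> u v | \<phi> u v. \<phi> \<in> hom G H \<and> u \<in> carrier H \<and> v \<in> carrier H \<and>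
              u \<otimes>\<^bsub>H\<^esub> inv\<^bsub>H\<^esub> v \<notin> \<phi> ` carrier G}"
proof -
  interpret H: free_basis H B
    using assms(2) by (auto simp: free_basis_def free_basis_axioms_def free_generating_set_def)
  show ?thesis
  proof (intro conjI allI impI)
    fix bs assume bs: "free_generators H bs"
    \<comment> \<open>The generators \<open>bs\<close> that encode endomorphisms may differ from the
      basis \<open>B\<close> that measures length; \<open>C\<close> compares the two. Inserting 0
      makes \<open>Max\<close> well defined without a proof that \<open>bs\<close> is
      nonempty.\<close>
    define C where "C = Max (insert 0 ((\<lambda>b. length (H.nf b)) ` set bs))"
    have C: "length (H.nf b) \<le> C" if "b \<in> set bs" for b
      unfolding C_def using that by (intro Max_ge) auto
    have car: "set bs \<subseteq> carrier H"
      using bs by (simp add: free_generators_def free_generating_set_def)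
    show "generic H B (length bs + 2)
        {triple_code bs \<phi> u v | \<phi> u v. \<phi> \<in> hom H H \<and> u \<in> carrier H \<and> v \<in> carrier H \<and>
          \<not> twisted_conjugate H \<phi> u v}"
      unfolding twisted_conjugate_def
    proof (rule generic_untwisted[OF bs assms(2-4), where g = "\<lambda>z. z" and C = C])
      fix w assume "w \<in> reduced_words (set bs)"
      then show "reduced_length H B (word_value H w) \<le> C * length w"
        unfolding H.reduced_length_eq using C car
        by (intro H.length_nf_word_value[of _ "set bs"]) (auto simp: reduced_words_def)
    qed
  next
    have "generic H B (length as + 2)
        {triple_code as \<phi> u v | \<phi> u v. \<phi> \<in> hom G H \<and> u \<in> carrier H \<and> v \<in> carrier H \<and>
          \<not> (\<exists>z \<in> carrier G. u = \<phi> z \<otimes>\<^bsub>H\<^esub> v \<otimes>\<^bsub>H\<^esub> inv\<^bsub>H\<^esub> \<one>\<^bsub>H\<^esub>)}"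
      by (rule generic_untwisted[OF assms, where g = "\<lambda>z. \<one>\<^bsub>H\<^esub>" and C = 0])
        (auto simp: H.reduced_length_eq)
    \<comment> \<open>With trivial \<open>g\<close> the twisted equation reads
      \<open>u = \<phi> z \<otimes> v\<close>, which is membership of
      \<open>u \<otimes> inv v\<close> in the image.\<close>
    moreover have "(\<exists>z \<in> carrier G. u = \<phi> z \<otimes>\<^bsub>H\<^esub> v \<otimes>\<^bsub>H\<^esub> inv\<^bsub>H\<^esub> \<one>\<^bsub>H\<^esub>) \<longleftrightarrow>
        u \<otimes>\<^bsub>H\<^esub> inv\<^bsub>H\<^esub> v \<in> \<phi> ` carrier G"
      if "\<phi> \<in> hom G H" "u \<in> carrier H" "v \<in> carrier H" for \<phi> u v
    proof -
      have "u = \<phi> z \<otimes>\<^bsub>H\<^esub> v \<otimes>\<^bsub>H\<^esub> inv\<^bsub>H\<^esub> \<one>\<^bsub>H\<^esub> \<longleftrightarrow> u \<otimes>\<^bsub>H\<^esub> inv\<^bsub>H\<^esub> v = \<phi> z" if "z \<in> carrier G" for z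
      proof -
        have "\<phi> z \<in> carrier H" using \<open>\<phi> \<in> hom G H\<close> that by (auto simp: hom_def)
        then show ?thesis using \<open>u \<in> carrier H\<close> \<open>v \<in> carrier H\<close>
          by (auto simp: H.inv_solve_right' H.m_assoc)
      qed
      then show ?thesis by (auto simp: image_iff)
    qed
    ultimately show "generic H B (length as + 2)
        {triple_code as \<phi> u v | \<phi> u v. \<phi> \<in> hom G H \<and> u \<in> carrier H \<and> v \<in> carrier H \<and>
          u \<otimes>\<^bsub>H\<^esub> inv\<^bsub>H\<^esub> v \<notin> \<phi> ` carrier G}"
      by (smt (verit) Collect_cong)
  qed
qed

end
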